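(* Let $X$ be a time-homogeneous Markov chain of order $m\ge1$ on a finite alphabet $A$, with transition kernel $p$ and skeleton of order $K\in\{1,\dots,m\}$. Suppose that $X$ is irreducible. Then the only two possible cases are $K=m$ or $K=1$. In the case $K=1$, we have $p(\mathbf{x},a)>0$ for all $\mathbf{x}\in A^m$ and $a\in A$.
   Context: Words: $A$ is a finite set. For $\mathbf{x}\in A^k$, $\mathbf{x}_i^j=(x_i,\dots,x_j)$ for $1\le i\le j\le k$, and $\mathbf{x}_i^j=\mathbf{e}$ (the empty word) if $i>j$; $A^0=\{\mathbf{e}\}$. Juxtaposition denotes concatenation. Kernel: $p:A^m\times A\to[0,1]$, $p(\mathbf{x},a)=P(X_{n+1}=a\mid X_n=x_m,X_{n-1}=x_{m-1},\dots,X_{n-m+1}=x_1)$ for $n\ge m-1$, so $x_m$ is the most recent symbol, and $\sum_{a\in A}p(\mathbf{x},a)=1$. Equivalently, $X$ can be seen as a Markov chain of order 1 on $A^m$, with transition matrix $\mathbb{P}$ given by $\mathbb{P}(\mathbf{x},\mathbf{x}_2^m a)=p(\mathbf{x},a)$ for $\mathbf{x}\in A^m$, $a\in A$, all other entries being $0$. $X$ is irreducible if $\mathbb{P}$ is irreducible on $A^m$. Skeleton order: for $\mathbf{x}\in A^m$ and $a\in A$, $$\tau(\mathbf{x},a)=\min\{i\ge 0:\ p(\mathbf{y}\mathbf{x}_{m-i}^m,a)=0\ \forall \mathbf{y}\in A^{m-i-1},\ \text{or}\ p(\mathbf{y}\mathbf{x}_{m-i}^m,a)>0\ \forall \mathbf{y}\in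 A^{m-i-1}\},$$ and $\tau_{\mathbf{x}}=\sup_{a\in A}\tau(\mathbf{x},a)$. The skeleton of $p$ is $\mathcal{S}=\bigcup_{\mathbf{x}\in A^m}\{\mathbf{x}_{m-\tau_{\mathbf{x}}}^m\}$ and its order is $K=1+\sup_{\mathbf{x}\in A^m}\tau_{\mathbf{x}}\in\{1,\dots,m\}$.
   Formalization: The positivity of p in the case K=1 is stated only when K≠m, i.e. for m≥2; for m=1 one always has K=1=m and positivity can fail, e.g. A={0,1} with p(0,1)=p(1,0)=1 is irreducible but p(0,0)=0. *)

theory Defs
  imports "HOL-Probability.Probability" "HOL-Library.NList"
begin

text \<open>
  The set of words of length \<open>k\<close> over \<open>A\<close> is \<open>nlists k A\<close>. The last letter of a word is the
  most recent symbol. Letters of a list are indexed from \<open>0\<close>, so for \<open>x = x_1 \<dots> x_m\<close> the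
  suffix \<open>x_{m-i}, \<dots>, x_m\<close> of length \<open>i + 1\<close> is \<open>drop (m - i - 1) x\<close>.
\<close>

definition transition_kernel :: "'a set \<Rightarrow> nat \<Rightarrow> ('a list \<Rightarrow> 'a \<Rightarrow> real) \<Rightarrow> bool" where
  "transition_kernel A m p \<longleftrightarrow>
     (\<forall>x\<in>nlists m A. (\<forall>a\<in>A. p x a \<in> {0..1}) \<and> (\<Sum>a\<in>A. p x a) = 1)"

definition trajectory :: "(nat \<Rightarrow> 'w \<Rightarrow> 'a) \<Rightarrow> nat \<Rightarrow> nat \<Rightarrow> 'w \<Rightarrow> 'a list" where
  "trajectory X s t \<omega> = map (\<lambda>i. X i \<omega>) [s..<t]"

text \<open>
  Identities between conditional probabilities are required only where the conditioning event
  has positive probability (elsewhere the quotient defining \<open>cond_prob\<close> is \<open>0\<close>).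
\<close>

locale markov_chain_of_order = prob_space M
  for M :: "'w measure" and X :: "nat \<Rightarrow> 'w \<Rightarrow> 'a"
    and A :: "'a set" and m :: nat and p :: "'a list \<Rightarrow> 'a \<Rightarrow> real" +
  assumes kernel: "transition_kernel A m p"
    and random_variable: "X t \<in> measurable M (count_space A)"
    and markov_property:
      "\<lbrakk>m \<le> t; w \<in> nlists t A; a \<in> A; \<P>(\<omega> in M. trajectory X 0 t \<omega> = w) > 0\<rbrakk> \<Longrightarrow>
         \<P>(\<omega> in M. X t \<omega> = a \<bar> trajectory X 0 t \<omega> = w) =
         \<P>(\<omega> in M. X t \<omega> = a \<bar> trajectory X (t - m) t \<omega> = drop (t - m) w)"
    and transition_probability:
      "\<lbrakk>m \<le> t; x \<in> nlists m A; a \<in> A; \<P>(\<omega> in M. trajectory X (t - m) t \<omega> = x) > 0\<rbrakk> \<Longrightarrow>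
         \<P>(\<omega> in M. X t \<omega> = a \<bar> trajectory X (t - m) t \<omega> = x) = p x a"

definition transition_matrix :: "('a list \<Rightarrow> 'a \<Rightarrow> real) \<Rightarrow> 'a list \<Rightarrow> 'a list \<Rightarrow> real" where
  "transition_matrix p x y = (if y \<noteq> [] \<and> butlast y = tl x then p x (last y) else 0)"

primrec matrix_power :: "'s set \<Rightarrow> ('s \<Rightarrow> 's \<Rightarrow> real) \<Rightarrow> nat \<Rightarrow> 's \<Rightarrow> 's \<Rightarrow> real" where
  "matrix_power S P 0 x y = (if x = y then 1 else 0)"
| "matrix_power S P (Suc n) x y = (\<Sum>z\<in>S. matrix_power S P n x z * P z y)"

text \<open>
  The power \<open>n = 0\<close> is allowed; for stochastic matrices requiring \<open>n \<ge> 1\<close> gives the same notion.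
\<close>

definition irreducible_matrix :: "'s set \<Rightarrow> ('s \<Rightarrow> 's \<Rightarrow> real) \<Rightarrow> bool" where
  "irreducible_matrix S P \<longleftrightarrow> (\<forall>x\<in>S. \<forall>y\<in>S. \<exists>n. matrix_power S P n x y > 0)"

definition irreducible_chain :: "'a set \<Rightarrow> nat \<Rightarrow> ('a list \<Rightarrow> 'a \<Rightarrow> real) \<Rightarrow> bool" where
  "irreducible_chain A m p \<longleftrightarrow> irreducible_matrix (nlists m A) (transition_matrix p)"

text \<open>
  For \<open>m \<ge> 1\<close> the condition below holds at \<open>i = m - 1\<close>, where only the empty prefix occurs. Hence
  the minimum exists and is at most \<open>m - 1\<close>, and \<open>m - i - 1\<close> is never truncated there.
\<close>

definition skeleton_tau :: "'a set \<Rightarrow> nat \<Rightarrow> ('a list \<Rightarrow> 'a \<Rightarrow> real) \<Rightarrow> 'a list \<Rightarrow> 'a \<Rightarrow> nat" where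
  "skeleton_tau A m p x a =
     (LEAST i. (\<forall>y\<in>nlists (m - i - 1) A. p (y @ drop (m - i - 1) x) a = 0) \<or>
               (\<forall>y\<in>nlists (m - i - 1) A. p (y @ drop (m - i - 1) x) a > 0))"

definition skeleton_tau_word :: "'a set \<Rightarrow> nat \<Rightarrow> ('a list \<Rightarrow> 'a \<Rightarrow> real) \<Rightarrow> 'a list \<Rightarrow> nat" where
  "skeleton_tau_word A m p x = (SUP a\<in>A. skeleton_tau A m p x a)"

definition skeleton :: "'a set \<Rightarrow> nat \<Rightarrow> ('a list \<Rightarrow> 'a \<Rightarrow> real) \<Rightarrow> 'a list set" where
  "skeleton A m p = (\<lambda>x. drop (m - skeleton_tau_word A m p x - 1) x) ` nlists m A"

text \<open>
  This is the length of the longest word in \<open>skeleton A m p\<close>. For \<open>m = 1\<close> it is always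
  \<open>1 = m\<close>, even for kernels with zero entries, so the cases of order \<open>m\<close> and of order \<open>1\<close>
  are distinct only for \<open>m \<ge> 2\<close>.
\<close>

definition skeleton_order :: "'a set \<Rightarrow> nat \<Rightarrow> ('a list \<Rightarrow> 'a \<Rightarrow> real) \<Rightarrow> nat" where
  "skeleton_order A m p = 1 + (SUP x\<in>nlists m A. skeleton_tau_word A m p x)"

end

theory Submission
  imports Defs
begin

text \<open>
  If \<open>K < m\<close>, then whether \<open>p x a\<close> vanishes does not depend on the first letter of \<open>x\<close>. So
  \<open>p x a = 0\<close> would make the whole column of the transition matrix at the word \<open>tl x @ [a]\<close>
  vanish, and this word could not be reached from any other one.
\<close>

lemma finite_nlists:
  assumes "finite A"
  shows "finite (nlists n A)"
  using finite_lists_length_eq[OF assms, of n] unfolding nlists_def by (simp only: conj_commute)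

text \<open>A path from \<open>x\<close> to \<open>y\<close> enters \<open>y\<close> by a last step,
  so some entry of column \<open>y\<close> is nonzero. The condition \<open>x \<noteq> y\<close>
  excludes the power 0, by which every state trivially reaches itself.\<close>

lemma irreducible_matrix_column_nonzero:
  assumes "irreducible_matrix S P" and "x \<in> S" "y \<in> S" "x \<noteq> y"
  shows "\<exists>z\<in>S. P z y \<noteq> 0"
proof (rule ccontr)
  assume zero: "\<not> (\<exists>z\<in>S. P z y \<noteq> 0)"
  obtain n where n: "matrix_power S P n x y > 0"
    using assms(1-3) unfolding irreducible_matrix_def by meson
  have "matrix_power S P n x y = 0"
  proof (cases n)
    case 0
    with assms(4) show ?thesis by simp
  next
    case (Suc k)
    have "(\<Sum>z\<in>S. matrix_power S P k x z * P z y) = 0"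
      by (rule sum.neutral) (use zero in auto)
    with Suc show ?thesis by simp
  qed
  with n show False by simp
qed

lemma skeleton_tau_le:
  assumes "m \<ge> 1" and "p x a \<ge> 0"
  shows "skeleton_tau A m p x a \<le> m - 1"
  unfolding skeleton_tau_def by (rule Least_le) (use assms in auto)

lemma skeleton_tau_cases:
  fixes A :: "'a set"
  assumes "m \<ge> 1" and "p x a \<ge> 0"
  defines "k \<equiv> m - skeleton_tau A m p x a - 1"
  shows "(\<forall>y\<in>nlists k A. p (y @ drop k x) a = 0) \<or> (\<forall>y\<in>nlists k A. p (y @ drop k x) a > 0)"
proof -
  let ?Q = "\<lambda>i. (\<forall>y\<in>nlists (m - i - 1) A. p (y @ drop (m - i - 1) x) a = 0) \<or>
    (\<forall>y\<in>nlists (m - i - 1) A. p (y @ drop (m - i - 1) x) a > 0)"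
  \<comment> \<open>The only prefix here is empty and \<open>drop 0 x = x\<close>, so the
    alternative reads \<open>p x a = 0\<close> or \<open>p x a > 0\<close>, which is
    nonnegativity.\<close>
  have "?Q (m - 1)"
    using assms by auto
  then have "?Q (LEAST i. ?Q i)"
    by (rule LeastI[where P = ?Q])
  then show ?thesis
    unfolding k_def skeleton_tau_def .
qed

text \<open>Finiteness of \<open>A\<close> bounds both families of naturals, so that each supremum
  really is an upper bound.\<close>

lemma skeleton_tau_less_order:
  assumes "finite A" "x \<in> nlists m A" "a \<in> A"
  shows "skeleton_tau A m p x a < skeleton_order A m p"
proof -
  have "skeleton_tau A m p x a \<le> skeleton_tau_word A m p x"
    unfolding skeleton_tau_word_def
    using assms by (intro cSUP_upper) auto
  also have "\<dots> \<le> (SUP x\<in>nlists m A. skeleton_tau_word A m p x)"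
    using assms by (intro cSUP_upper) (auto simp: finite_nlists)
  finally show ?thesis
    unfolding skeleton_order_def by linarith
qed

lemma skeleton_order_le:
  assumes "A \<noteq> {}"
    and "\<And>x a. x \<in> nlists m A \<Longrightarrow> a \<in> A \<Longrightarrow> skeleton_tau A m p x a \<le> n"
  shows "skeleton_order A m p \<le> 1 + n"
proof -
  have "nlists m A \<noteq> {}"
    using nlists_not_empty[OF assms(1), of m] by blast
  moreover have "skeleton_tau_word A m p x \<le> n" if "x \<in> nlists m A" for x
    unfolding skeleton_tau_word_def by (rule cSUP_least[OF assms(1)]) (rule assms(2)[OF that])
  ultimately have "(SUP x\<in>nlists m A. skeleton_tau_word A m p x) \<le> n"
    by (rule cSUP_least)
  then show ?thesis
    unfolding skeleton_order_def by simp
qed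

text \<open>This settles the degenerate chain with a single state, to which the column argument does
  not apply. Constant words over distinct letters would differ, so \<open>A\<close> has one letter
  and the row sum is the single term \<open>p x a\<close>.\<close>

lemma transition_kernel_singleton:
  assumes "transition_kernel A m p" "nlists m A \<subseteq> {y}" "m \<ge> 1"
    and "x \<in> nlists m A" "a \<in> A"
  shows "p x a = 1"
proof -
  have "b = a" if "b \<in> A" for b
  proof -
    have "replicate m b = replicate m a"
      using assms(2) nlists_replicateI[OF that, of m] nlists_replicateI[OF assms(5), of m]
      by (metis singletonD subsetD)
    with assms(3) show ?thesis by simp
  qed
  then have "A = {a}"
    using assms(5) by blast
  moreover have "(\<Sum>a\<in>A. p x a) = 1"
    using assms(1,4) unfolding transition_kernel_def by blast
  ultimately show ?thesis by simp
qed

lemma kernel_pos_if_order_less: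
  assumes "finite A" "m \<ge> 1" "transition_kernel A m p" "irreducible_chain A m p"
    and less: "skeleton_order A m p < m"
    and x: "x \<in> nlists m A" and a: "a \<in> A"
  shows "p x a > 0"
proof (rule ccontr)
  assume "\<not> p x a > 0"
  moreover have nonneg: "p x a \<ge> 0"
    using assms(3) x a by (simp add: transition_kernel_def)
  ultimately have p0: "p x a = 0" by simp
  define k where "k = m - skeleton_tau A m p x a - 1"
  \<comment> \<open>As \<tau> < K < m, the order \<tau> is at most m - 2. Hence the free prefix of
    length \<open>k\<close> contains at least the first letter.\<close>
  have k: "1 \<le> k" "k < m"
    using skeleton_tau_less_order[OF assms(1) x a, of p] less unfolding k_def by auto
  have len: "length x = m" "set x \<subseteq> A"
    using x by simp_all
  have take_k: "take k z \<in> nlists k A" if "z \<in> nlists m A" for z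
    using that k(2) by (auto intro!: nlistsI dest: in_set_takeD subsetD[OF nlistsE_set])
  \<comment> \<open>The word \<open>x\<close> itself, split after \<open>k\<close> letters, refutes
    the positive alternative.\<close>
  have "\<not> p (take k x @ drop k x) a > 0"
    using p0 by simp
  with take_k[OF x] have "\<not> (\<forall>y\<in>nlists k A. p (y @ drop k x) a > 0)"
    by blast
  then have zero: "\<forall>y\<in>nlists k A. p (y @ drop k x) a = 0"
    using skeleton_tau_cases[where A = A, of m p x a, OF assms(2) nonneg, folded k_def] by blast
  \<comment> \<open>The words \<open>z\<close> with the tail of \<open>x\<close> are the only ones
    that can move to \<open>tl x @ [a]\<close>; they differ from \<open>x\<close> at most in the
    first letter, which lies in the free prefix.\<close>
  have column_zero: "p z a = 0" if z: "z \<in> nlists m A" and tl: "tl z = tl x" for z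
  proof -
    have "drop k z = drop k x"
      using k(1) tl by (cases k) (simp_all add: drop_Suc)
    then have "take k z @ drop k x = z"
      using append_take_drop_id[of k z] by simp
    then show ?thesis
      using bspec[OF zero take_k[OF z]] by simp
  qed
  define y where "y = tl x @ [a]"
  have y: "y \<in> nlists m A"
    unfolding y_def using len a assms(2) by (cases x) (auto intro!: nlistsI)
  have "\<not> nlists m A \<subseteq> {y}"
    using transition_kernel_singleton[OF assms(3) _ assms(2) x a, of y] p0 by auto
  then obtain w where "w \<in> nlists m A" "w \<noteq> y"
    by auto
  then obtain z where "z \<in> nlists m A" "transition_matrix p z y \<noteq> 0"
    using irreducible_matrix_column_nonzero y assms(4) unfolding irreducible_chain_def by metis
  then show False
    using column_zero[of z] by (auto simp: transition_matrix_def y_def split: if_splits)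
qed

theorem proposition2:
  fixes M :: "'w measure" and X :: "nat \<Rightarrow> 'w \<Rightarrow> 'a" and A :: "'a set"
    and m K :: nat and p :: "'a list \<Rightarrow> 'a \<Rightarrow> real"
  assumes "finite A"
    and "m \<ge> 1"
    and "markov_chain_of_order M X A m p"
    and "K = skeleton_order A m p"
    and "irreducible_chain A m p"
  shows "(K = m \<or> K = 1) \<and>
         (K = 1 \<and> K \<noteq> m \<longrightarrow> (\<forall>x\<in>nlists m A. \<forall>a\<in>A. p x a > 0))"
proof -
  interpret markov_chain_of_order M X A m p
    by (rule assms(3))
  \<comment> \<open>A probability space has a point, and \<open>X 0\<close> maps it into
    \<open>A\<close>.\<close>
  have A: "A \<noteq> {}"
    using not_empty random_variable[of 0] by (auto simp: measurable_def)
  have nonneg: "p x a \<ge> 0" if "x \<in> nlists m A" "a \<in> A" for x a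
    using kernel that by (auto simp: transition_kernel_def)
  have "K \<le> 1 + (m - 1)"
    unfolding assms(4) using A nonneg assms(2) by (intro skeleton_order_le skeleton_tau_le)
  \<comment> \<open>Since K is at least 1 by definition, this case forces m \<ge> 2. For m = 1 the
    order equals m, and zero entries may occur.\<close>
  moreover have "K = 1 \<and> (\<forall>x\<in>nlists m A. \<forall>a\<in>A. p x a > 0)" if "K < m"
  proof -
    have pos: "p x a > 0" if "x \<in> nlists m A" "a \<in> A" for x a
      using kernel_pos_if_order_less[OF assms(1,2) kernel assms(5) _ that] \<open>K < m\<close> assms(4)
      by simp
    \<comment> \<open>With all entries positive, the positive alternative already holds at
      \<open>i = 0\<close>.\<close>
    have "skeleton_tau A m p x a \<le> 0" if x: "x \<in> nlists m A" and "a \<in> A" for x a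
    proof -
      have "y @ drop (m - 1) x \<in> nlists m A" if "y \<in> nlists (m - 1) A" for y
      proof (rule nlistsI)
        show "length (y @ drop (m - 1) x) = m"
          using that x assms(2) by simp
        show "set (y @ drop (m - 1) x) \<subseteq> A"
          unfolding set_append
          by (intro Un_least nlistsE_set[OF that] subset_trans[OF set_drop_subset nlistsE_set[OF x]])
      qed
      then show ?thesis
        unfolding skeleton_tau_def using pos \<open>a \<in> A\<close> by (intro Least_le) auto
    qed
    then have "K \<le> 1 + 0"
      unfolding assms(4) using A by (intro skeleton_order_le)
    then show ?thesis
      using pos unfolding assms(4) skeleton_order_def by auto
  qed
  moreover have "K = m" if "\<not> K < m"
    using \<open>K \<le> 1 + (m - 1)\<close> assms(2) that by linarith
  ultimately show ?thesis
    by blast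
qed

end
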